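(* Let $\mathfrak{D}$ be a $9$-dimensional indecomposable dual mock-Lie algebra over $\mathbb{C}$ which is not a Lie algebra. Then $\mathfrak{D}$ is isomorphic to $\mathfrak{D}^9_{37}$ or to $\mathfrak{D}^9_{38}$, where these algebras have basis $e_1,\dots,e_9$ and multiplication tables $$\mathfrak{D}^9_{37}:\quad e_1e_2=e_4,\ e_1e_3=e_5,\ e_2e_3=e_6,\ e_1e_6=e_8,\ e_2e_5=-e_8,\ e_3e_4=e_8,\ e_3e_7=-e_9;$$ $$\mathfrak{D}^9_{38}:\quad e_1e_2=e_4,\ e_1e_3=e_5,\ e_2e_3=e_6,\ e_1e_6=e_9,\ e_2e_5=-e_9,\ e_3e_4=e_9,\ e_7e_8=e_9.$$
   Context: A dual mock-Lie algebra over $\mathbb{C}$ is a complex vector space with a bilinear product $(x,y)\mapsto xy$ that is anticommutative, $xy=-yx$, and antiassociative, $(xy)z=-x(yz)$ for all $x,y,z$. An algebra is indecomposable if it is not a direct sum of two nonzero ideals. In multiplication tables, the products $e_je_i=-e_ie_j$ are determined by anticommutativity, and all products of basis elements not determined by the listed ones in this way are zero. *)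

theory Defs
  imports "HOL-Analysis.Analysis"
begin

locale nonassoc_algebra = vector_space scale
  for scale :: "complex \<Rightarrow> 'a::ab_group_add \<Rightarrow> 'a" +
  fixes mul :: "'a \<Rightarrow> 'a \<Rightarrow> 'a"
  assumes linear_mult_left: "Vector_Spaces.linear scale scale (\<lambda>x. mul x y)"
    and linear_mult_right: "Vector_Spaces.linear scale scale (mul x)"
begin

definition ideal :: "'a set \<Rightarrow> bool" where
  "ideal I \<longleftrightarrow> subspace I \<and> (\<forall>x. \<forall>a\<in>I. mul x a \<in> I \<and> mul a x \<in> I)"

definition indecomposable :: bool where
  "indecomposable \<longleftrightarrow>
    \<not> (\<exists>I J. ideal I \<and> ideal J \<and> I \<noteq> {0} \<and> J \<noteq> {0} \<and>
        I \<inter> J = {0} \<and> {a + b | a b. a \<in> I \<and> b \<in> J} = UNIV)"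

end

locale dual_mock_lie_algebra = nonassoc_algebra +
  assumes anticommutative: "mul x y = - mul y x"
    and antiassociative: "mul (mul x y) z = - mul x (mul y z)"

locale lie_algebra = nonassoc_algebra +
  assumes alternating: "mul x x = 0"
    and jacobi: "mul (mul x y) z + mul (mul y z) x + mul (mul z x) y = 0"

definition algebra_isomorphic ::
  "(complex \<Rightarrow> 'a::ab_group_add \<Rightarrow> 'a) \<Rightarrow> ('a \<Rightarrow> 'a \<Rightarrow> 'a) \<Rightarrow>
   (complex \<Rightarrow> 'b::ab_group_add \<Rightarrow> 'b) \<Rightarrow> ('b \<Rightarrow> 'b \<Rightarrow> 'b) \<Rightarrow> bool" where
  "algebra_isomorphic scale1 mul1 scale2 mul2 \<longleftrightarrow>
    (\<exists>f. Vector_Spaces.linear scale1 scale2 f \<and> bij f \<and>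
      (\<forall>x y. f (mul1 x y) = mul2 (f x) (f y)))"

text \<open>
  An entry \<open>(i, j, k, c)\<close> of a multiplication table stands for
  \<open>e\<^sub>i e\<^sub>j = c e\<^sub>k\<close>, and hence also for \<open>e\<^sub>j e\<^sub>i = - c e\<^sub>k\<close>, where \<open>e\<^sub>i = axis i 1\<close>. The
  product is the bilinear extension, with all other products of basis vectors equal to zero.
  A table lists each unordered pair \<open>{i, j}\<close> at most once, with \<open>i \<noteq> j\<close>.
\<close>

definition table_mult ::
  "('n::finite \<times> 'n \<times> 'n \<times> complex) list \<Rightarrow> complex^'n \<Rightarrow> complex^'n \<Rightarrow> complex^'n" where
  "table_mult T x y =
    (\<Sum>(i, j, k, c)\<leftarrow>T. (c * (x $ i * y $ j - x $ j * y $ i)) *s axis k 1)"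

text \<open>
  The indices below are elements of the nine-element type \<open>9\<close>, in which \<open>1, \<dots>, 9\<close> are
  pairwise distinct (and \<open>9 = 0\<close>).
\<close>

definition D9_37 :: "complex^9 \<Rightarrow> complex^9 \<Rightarrow> complex^9" where
  "D9_37 = table_mult
    [(1, 2, 4, 1), (1, 3, 5, 1), (2, 3, 6, 1),
     (1, 6, 8, 1), (2, 5, 8, -1), (3, 4, 8, 1), (3, 7, 9, -1)]"

definition D9_38 :: "complex^9 \<Rightarrow> complex^9 \<Rightarrow> complex^9" where
  "D9_38 = table_mult
    [(1, 2, 4, 1), (1, 3, 5, 1), (2, 3, 6, 1),
     (1, 6, 9, 1), (2, 5, 9, -1), (3, 4, 9, 1), (7, 8, 9, 1)]"

end

theory Submission
  imports Defs
begin

text \<open>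
  Products of four elements vanish, and \<open>(x y) z\<close> is alternating; so the Jacobi identity reads
  \<open>3 (x y) z = 0\<close>, and in a non-Lie algebra some \<open>t = (a b) c\<close> is nonzero. If the trilinear map
  \<open>(x y) z\<close> had values outside \<open>\<complex> t\<close>, or if it did not depend on three coordinates only, then
  the algebra would contain ten linearly independent vectors. Hence every element is a combination
  of \<open>a, b, c\<close> plus an element of the radical \<open>{x. (x y) z = 0 for all y, z}\<close>, which has
  dimension 6 and contains \<open>a b, a c, b c, t\<close>.

  If \<open>x c \<notin> \<complex> t\<close> for some \<open>x\<close> in the radical (up to rotating \<open>a, b, c\<close>), then
  \<open>a, b, c, a b, a c, b c, x, t, x c\<close> is a basis, and correcting \<open>a, b\<close> by multiples of \<open>c\<close> and
  \<open>x\<close> by products of \<open>a, b, c\<close> gives the first table. Otherwise, correcting by products of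
  \<open>a, b, c\<close>, the radical is spanned by \<open>a b, a c, b c\<close> and elements that annihilate
  \<open>a, b, c\<close>. Two of these have a nonzero product, which gives the second table, or else one
  of them outside \<open>\<complex> t\<close> spans a direct summand.
\<close>

section \<open>Linear algebra\<close>

lemma UNIV_9: "(UNIV :: 9 set) = {1, 2, 3, 4, 5, 6, 7, 8, 9}"
proof (rule card_subset_eq[symmetric])
  show "card {1, 2, 3, 4, 5, 6, 7, 8, 9 :: 9} = card (UNIV :: 9 set)"
    by (simp only: card_insert_if finite.intros insert_iff empty_iff) simp
qed simp_all

lemma sum_UNIV_9:
  "(\<Sum>i\<in>(UNIV :: 9 set). f i) = f 1 + f 2 + f 3 + f 4 + f 5 + f 6 + f 7 + f 8 + f 9"
  unfolding UNIV_9 by (simp add: add.assoc)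

lemma all_9:
  "(\<forall>i :: 9. P i) \<longleftrightarrow> P 1 \<and> P 2 \<and> P 3 \<and> P 4 \<and> P 5 \<and> P 6 \<and> P 7 \<and> P 8 \<and> P 9"
proof -
  have "(\<forall>i :: 9. P i) \<longleftrightarrow> (\<forall>i\<in>{1, 2, 3, 4, 5, 6, 7, 8, 9}. P i)"
    by (simp only: UNIV_9[symmetric] ball_UNIV)
  then show ?thesis
    by simp
qed

context vector_space
begin

text \<open>Equal members at two indices would satisfy a nontrivial relation, so for an indexed
  family independence includes injectivity.\<close>

lemma independent_family:
  assumes "finite I"
    and "\<And>k. (\<Sum>i\<in>I. scale (k i) (e i)) = 0 \<Longrightarrow> (\<forall>i\<in>I. k i = 0)"
  shows "inj_on e I" "independent (e ` I)"
proof -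
  show inj: "inj_on e I"
  proof (rule inj_onI, rule ccontr)
    fix i j assume ij: "i \<in> I" "j \<in> I" "e i = e j" "i \<noteq> j"
    \<comment> \<open>The relation \<open>e i - e j = 0\<close>.\<close>
    define k where "k l = (if l = i then 1 else if l = j then - 1 else 0 :: 'a)" for l
    have "(\<Sum>l\<in>I. scale (k l) (e l)) = (\<Sum>l\<in>{i, j}. scale (k l) (e l))"
      using assms(1) ij by (intro sum.mono_neutral_right) (auto simp: k_def)
    also have "\<dots> = 0"
      using ij by (simp add: k_def)
    finally have "k i = 0"
      using assms(2)[of k] ij(1) by simp
    then show False
      by (simp add: k_def)
  qed
  show "independent (e ` I)"
  proof (rule independent_if_scalars_zero)
    fix f x assume f: "(\<Sum>x\<in>e ` I. scale (f x) x) = 0" and x: "x \<in> e ` I"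
    have "(\<Sum>i\<in>I. scale (f (e i)) (e i)) = 0"
      using f by (simp add: sum.reindex[OF inj])
    then show "f x = 0"
      using assms(2)[of "\<lambda>i. f (e i)"] x by auto
  qed (use assms(1) in simp)
qed

text \<open>\<open>card\<close> is 0 on infinite sets, so a positive \<open>dim\<close> already
  forces a finite basis.\<close>

lemma finite_spanning_basis:
  assumes "dim (UNIV :: 'b set) > 0"
  obtains B where "finite B" "independent B" "span B = UNIV" "card B = dim (UNIV :: 'b set)"
proof -
  obtain B where B: "independent B" "(UNIV :: 'b set) \<subseteq> span B"
    using maximal_independent_subset[of UNIV] by metis
  then have "card B = dim (UNIV :: 'b set)"
    by (intro basis_card_eq_dim) auto
  moreover from this have "finite B"
    using assms by (intro card_ge_0_finite) simp
  ultimately show thesis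
    using B by (intro that) auto
qed

lemma family_card_le_dim:
  assumes "dim (UNIV :: 'b set) > 0" and "finite I"
    and "\<And>k. (\<Sum>i\<in>I. scale (k i) (e i)) = 0 \<Longrightarrow> (\<forall>i\<in>I. k i = 0)"
  shows "card I \<le> dim (UNIV :: 'b set)"
proof -
  obtain B where B: "finite B" "span B = UNIV" "card B = dim (UNIV :: 'b set)"
    using finite_spanning_basis[OF assms(1)] by metis
  have "card (e ` I) \<le> card B"
    using independent_span_bound[OF B(1), of "e ` I"] independent_family[OF assms(2,3)] B by auto
  then show ?thesis
    using independent_family(1)[OF assms(2,3)] B by (simp add: card_image)
qed

lemma family_spans:
  assumes "dim (UNIV :: 'b set) > 0" and "finite I" and "card I = dim (UNIV :: 'b set)"
    and "\<And>k. (\<Sum>i\<in>I. scale (k i) (e i)) = 0 \<Longrightarrow> (\<forall>i\<in>I. k i = 0)"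
  shows "span (e ` I) = UNIV"
proof -
  note ind = independent_family[OF assms(2,4)]
  have card: "card (e ` I) = dim (UNIV :: 'b set)"
    using assms(3) ind by (simp add: card_image)
  obtain B where B: "finite B" "span B = UNIV" "card B = dim (UNIV :: 'b set)"
    using finite_spanning_basis[OF assms(1)] by metis
  have "x \<in> span (e ` I)" for x
  proof (rule ccontr)
    assume x: "x \<notin> span (e ` I)"
    then have "independent (insert x (e ` I))"
      using ind independent_insertI by blast
    then have "card (insert x (e ` I)) \<le> card B"
      using independent_span_bound[OF B(1)] B by blast
    moreover have "x \<notin> e ` I"
      using x span_base by blast
    ultimately show False
      using card B assms(2) by simp
  qed
  then show ?thesis
    by blast
qed

text \<open>Multiplying this relation by suitable elements isolates its coefficients one after
  another. The sum is written out so that bilinear expansion can act on it.\<close>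

lemma ten_vectors_dependent:
  assumes "dim (UNIV :: 'b set) = 9"
  obtains k :: "nat \<Rightarrow> 'a" where
    "scale (k 0) x0 + scale (k 1) x1 + scale (k 2) x2 + scale (k 3) x3 + scale (k 4) x4 +
     scale (k 5) x5 + scale (k 6) x6 + scale (k 7) x7 + scale (k 8) x8 + scale (k 9) x9 = 0"
    "\<not> (k 0 = 0 \<and> k 1 = 0 \<and> k 2 = 0 \<and> k 3 = 0 \<and> k 4 = 0 \<and>
        k 5 = 0 \<and> k 6 = 0 \<and> k 7 = 0 \<and> k 8 = 0 \<and> k 9 = 0)"
proof -
  define e where "e = (!) [x0, x1, x2, x3, x4, x5, x6, x7, x8, x9]"
  have *: "{..<10 :: nat} = {0, 1, 2, 3, 4, 5, 6, 7, 8, 9}"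
    by auto
  have "\<not> card {..<10 :: nat} \<le> dim (UNIV :: 'b set)"
    using assms by simp
  then obtain k where "(\<Sum>i<10. scale (k i) (e i)) = 0" "\<not> (\<forall>i\<in>{..<10 :: nat}. k i = 0)"
    using family_card_le_dim[of "{..<10}" e] assms by auto
  then show thesis
    by (intro that[of k]) (simp_all add: * e_def add.assoc)
qed

text \<open>A basis of \<open>span S\<close> together with \<open>u\<close> extends to a basis of
  the whole space; discarding \<open>u\<close> leaves a hyperplane. It will serve as the ideal
  complementary to the line of \<open>u\<close>.\<close>

lemma separating_subspace:
  assumes "u \<notin> span S"
  obtains J where "subspace J" "S \<subseteq> J" "u \<notin> J" "\<forall>x. \<exists>k. x - scale k u \<in> J"
proof -
  obtain B where B: "B \<subseteq> S" "independent B" "S \<subseteq> span B"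
    using maximal_independent_subset[of S] by metis
  have u: "u \<notin> span B"
    using assms span_mono[OF B(1)] by blast
  have "independent (insert u B)"
    using independent_insertI u B(2) .
  then obtain C where C: "insert u B \<subseteq> C" "independent C" "UNIV \<subseteq> span C"
    using maximal_independent_subset_extend[OF subset_UNIV] by metis
  show thesis
  proof
    show "subspace (span (C - {u}))"
      by (rule subspace_span)
    have "B \<subseteq> C - {u}"
      using u C(1) span_base[of u B] by auto
    then show "S \<subseteq> span (C - {u})"
      using B(3) span_mono[of B "C - {u}"] by simp
    show "u \<notin> span (C - {u})"
      using C(1,2) unfolding dependent_def by auto
    show "\<forall>x. \<exists>k. x - scale k u \<in> span (C - {u})"
    proof
      fix x
      show "\<exists>k. x - scale k u \<in> span (C - {u})"
        using C(1) C(3)[THEN subsetD, OF UNIV_I] span_breakdown[of u C x] by blast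
    qed
  qed
qed

end

section \<open>Multiplication tables\<close>

lemma table_mult_Nil [simp]: "table_mult [] x y = 0"
  by (simp add: table_mult_def)

lemma table_mult_Cons [simp]:
  "table_mult ((i, j, k, c) # T) x y =
    (c * (x $ i * y $ j - x $ j * y $ i)) *s axis k 1 + table_mult T x y"
  by (simp add: table_mult_def)

context nonassoc_algebra
begin

lemma mul_add_left: "mul (x + y) z = mul x z + mul y z"
  and mul_scale_left: "mul (scale k x) z = scale k (mul x z)"
  and mul_minus_left: "mul (- x) z = - mul x z"
  and mul_diff_left: "mul (x - y) z = mul x z - mul y z"
  and mul_zero_left: "mul 0 z = 0"
proof -
  interpret Vector_Spaces.linear scale scale "\<lambda>x. mul x z"
    by (rule linear_mult_left)
  show "mul (x + y) z = mul x z + mul y z" "mul (scale k x) z = scale k (mul x z)"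
    "mul (- x) z = - mul x z" "mul (x - y) z = mul x z - mul y z" "mul 0 z = 0"
    by (rule add scale neg diff zero)+
qed

lemma mul_add_right: "mul z (x + y) = mul z x + mul z y"
  and mul_scale_right: "mul z (scale k x) = scale k (mul z x)"
  and mul_minus_right: "mul z (- x) = - mul z x"
  and mul_diff_right: "mul z (x - y) = mul z x - mul z y"
  and mul_zero_right: "mul z 0 = 0"
proof -
  interpret Vector_Spaces.linear scale scale "mul z"
    by (rule linear_mult_right)
  show "mul z (x + y) = mul z x + mul z y" "mul z (scale k x) = scale k (mul z x)"
    "mul z (- x) = - mul z x" "mul z (x - y) = mul z x - mul z y" "mul z 0 = 0"
    by (rule add scale neg diff zero)+
qed

lemmas bilinear_simps =
  mul_add_left mul_scale_left mul_minus_left mul_diff_left mul_zero_left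
  mul_add_right mul_scale_right mul_minus_right mul_diff_right mul_zero_right

lemma mul_sum_left: "mul (sum f A) z = (\<Sum>i\<in>A. mul (f i) z)"
  by (induction A rule: infinite_finite_induct) (simp_all add: bilinear_simps)

lemma mul_sum_right: "mul z (sum f A) = (\<Sum>i\<in>A. mul z (f i))"
  by (induction A rule: infinite_finite_induct) (simp_all add: bilinear_simps)

text \<open>Both products are bilinear, so agreement on basis vectors suffices. The difference of
  \<open>of_bool\<close> terms is the form \<open>x $ p * y $ q - x $ q * y $ p\<close> evaluated at
  \<open>axis i 1\<close> and \<open>axis j 1\<close>.\<close>

lemma isomorphic_table_mult:
  fixes e :: "'n::finite \<Rightarrow> 'a" and T :: "('n \<times> 'n \<times> 'n \<times> complex) list"
  assumes dim: "dim (UNIV :: 'a set) = CARD('n)"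
    and indep: "\<And>k. (\<Sum>i\<in>UNIV. scale (k i) (e i)) = 0 \<Longrightarrow> (\<forall>i. k i = 0)"
    and table: "\<And>i j. mul (e i) (e j) =
      (\<Sum>(p, q, k, c)\<leftarrow>T.
        scale (c * (of_bool (p = i \<and> q = j) - of_bool (p = j \<and> q = i))) (e k))"
  shows "algebra_isomorphic scale mul (*s) (table_mult T)"
proof -
  \<comment> \<open>From coordinates to the algebra the map is an explicit sum; the isomorphism
    sought is \<open>inv g\<close>.\<close>
  define g where "g x = (\<Sum>i\<in>UNIV. scale (x $ i) (e i))" for x :: "complex^'n"
  have g_add: "g (x + y) = g x + g y" for x y
    by (simp add: g_def scale_left_distrib sum.distrib)
  have g_scale: "g (c *s x) = scale c (g x)" for c x
    by (simp add: g_def scale_sum_right)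
  have g_0: "g 0 = 0"
    by (simp add: g_def)
  have g_axis: "g (axis i 1) = e i" for i
    by (simp add: g_def axis_def if_distrib[of "\<lambda>c. scale c _"] cong: if_cong)
  have lin: "Vector_Spaces.linear (*s) scale g"
    by unfold_locales (simp_all add: g_add g_scale)
  have inj: "inj g"
  proof (rule injI)
    fix x y assume "g x = g y"
    then have "(\<Sum>i\<in>UNIV. scale (x $ i - y $ i) (e i)) = 0"
      by (simp add: g_def scale_left_diff_distrib sum_subtractf)
    then show "x = y"
      using indep[of "\<lambda>i. x $ i - y $ i"] by (simp add: vec_eq_iff)
  qed
  have "span (range e) = UNIV"
  proof (rule family_spans)
    show "\<forall>i\<in>UNIV. k i = 0" if "(\<Sum>i\<in>UNIV. scale (k i) (e i)) = 0" for k
      using indep[OF that] by simp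
  qed (simp_all add: dim)
  moreover have "range e \<subseteq> range g"
    by (auto simp: g_axis[symmetric])
  moreover have "subspace (range g)"
  proof (rule subspaceI)
    show "0 \<in> range g"
      by (rule range_eqI[of _ _ 0]) (simp add: g_0)
    show "x + y \<in> range g" if xy: "x \<in> range g" "y \<in> range g" for x y
    proof -
      obtain u v where "x = g u" "y = g v"
        using xy by blast
      then show ?thesis
        by (intro range_eqI[of _ _ "u + v"]) (simp add: g_add)
    qed
    show "scale c x \<in> range g" if x: "x \<in> range g" for c x
    proof -
      obtain u where "x = g u"
        using x by blast
      then show ?thesis
        by (intro range_eqI[of _ _ "c *s u"]) (simp add: g_scale)
    qed
  qed
  ultimately have "UNIV \<subseteq> range g"
    using span_minimal[of "range e" "range g"] by simp
  then have surj: "surj g"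
    by (rule top.extremum_uniqueI)
  have bij: "bij g"
    using inj surj by (rule bijI)
  have tab_axis: "g (table_mult T (axis i 1) (axis j 1)) = mul (e i) (e j)" for i j
  proof -
    have ax: "axis i 1 $ p = of_bool (p = i)" for i p :: 'n
      by (simp add: axis_def)
    \<comment> \<open>The induction needs an arbitrary list \<open>S\<close>, since
      \<open>table\<close> speaks of the whole list \<open>T\<close> only.\<close>
    have "g (table_mult S (axis i 1) (axis j 1)) =
        (\<Sum>(p, q, k, c)\<leftarrow>S.
          scale (c * (of_bool (p = i \<and> q = j) - of_bool (p = j \<and> q = i))) (e k))"
      for S :: "('n \<times> 'n \<times> 'n \<times> complex) list"
      by (induction S) (auto simp: g_0 g_add g_scale g_axis ax of_bool_conj mult.commute)
    then show ?thesis
      by (simp only: table)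
  qed
  \<comment> \<open>Bilinearity of \<open>table_mult\<close>, entry by entry: each alternating form
    is recovered from its values on unit vectors.\<close>
  have tab_expand: "table_mult S x y =
      (\<Sum>i\<in>UNIV. \<Sum>j\<in>UNIV. (x $ i * y $ j) *s table_mult S (axis i 1) (axis j 1))"
    for x y and S :: "('n \<times> 'n \<times> 'n \<times> complex) list"
  proof (induction S)
    case Nil
    then show ?case by simp
  next
    case (Cons q S)
    obtain p p' k c where q: "q = (p, p', k, c)"
      using prod_cases4 .
    have ax: "(\<Sum>i\<in>UNIV. z $ i * axis i 1 $ l) = z $ l" for z :: "complex^'n" and l
    proof -
      have "(\<Sum>i\<in>UNIV. z $ i * axis i 1 $ l) = (\<Sum>i\<in>UNIV. if l = i then z $ i else 0)"
        by (rule sum.cong[OF refl]) (simp add: axis_def)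
      then show ?thesis
        by simp
    qed
    have prod: "(\<Sum>i\<in>UNIV. \<Sum>j\<in>UNIV. x $ i * y $ j * (axis i 1 $ l * axis j 1 $ l')) =
        x $ l * y $ l'"
      for l l'
    proof -
      have "(\<Sum>i\<in>UNIV. \<Sum>j\<in>UNIV. x $ i * y $ j * (axis i 1 $ l * axis j 1 $ l')) =
          (\<Sum>i\<in>UNIV. x $ i * axis i 1 $ l) * (\<Sum>j\<in>UNIV. y $ j * axis j 1 $ l')"
        unfolding sum_product by (intro sum.cong refl) (simp only: mult_ac)
      then show ?thesis
        by (simp only: ax)
    qed
    have coeff: "(\<Sum>i\<in>UNIV. \<Sum>j\<in>UNIV. (x $ i * y $ j) *
        (c * (axis i 1 $ p * axis j 1 $ p' - axis i 1 $ p' * axis j 1 $ p))) =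
        c * (x $ p * y $ p' - x $ p' * y $ p)"
      unfolding right_diff_distrib mult.left_commute[of _ c] sum_subtractf
        sum_distrib_left[symmetric] prod ..
    then show ?case
      unfolding q table_mult_Cons Cons coeff[symmetric]
      by (simp only: vec.scale_right_distrib sum.distrib vec.scale_sum_left vec.scale_scale)
  qed
  have mult: "g (table_mult T x y) = mul (g x) (g y)" for x y
  proof -
    have g_sum: "g (sum f A) = (\<Sum>i\<in>A. g (f i))" for f :: "'n \<Rightarrow> complex^'n" and A
      by (induction A rule: infinite_finite_induct) (simp_all add: g_0 g_add)
    have "g (table_mult T x y) = (\<Sum>i\<in>UNIV. \<Sum>j\<in>UNIV. scale (x $ i * y $ j) (mul (e i) (e j)))"
      by (subst tab_expand) (simp add: g_sum g_scale tab_axis)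
    also have "\<dots> = mul (g x) (g y)"
      unfolding g_def mul_sum_left mul_sum_right mul_scale_left mul_scale_right
        scale_sum_right scale_scale
      by (subst sum.swap) (intro sum.cong refl; simp only: mult.commute)
    finally show ?thesis .
  qed
  have "Vector_Spaces.linear scale (*s) (inv g)"
    by unfold_locales (simp_all add: inv_f_eq[OF inj] g_add g_scale surj_f_inv_f[OF surj])
  moreover have "inv g (mul x y) = table_mult T (inv g x) (inv g y)" for x y
    by (rule inv_f_eq[OF inj]) (simp add: mult surj_f_inv_f[OF surj])
  ultimately show ?thesis
    unfolding algebra_isomorphic_def using bij_imp_bij_inv[OF bij] by (intro exI[of _ "inv g"]) simp
qed

end

section \<open>Triple products and the radical\<close>

context dual_mock_lie_algebra
begin

text \<open>Characteristic other than 2 enters here: \<open>x + x = 0\<close> reads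
  \<open>scale 2 x = 0\<close>.\<close>

lemma eq_minus_self:
  fixes x :: 'a
  shows "x = - x \<Longrightarrow> x = 0"
proof -
  assume "x = - x"
  then have "x + x = 0"
    by (metis add.right_inverse)
  then have "scale 2 x = 0"
    using scale_left_distrib[of 1 1 x] by simp
  then show "x = 0"
    by simp
qed

lemma mul_mul_right: "mul x (mul y z) = - mul (mul x y) z"
  by (simp add: antiassociative)

text \<open>Two routes of rebracketing lead from \<open>((x y) z) w\<close> to
  \<open>x (y (z w))\<close>, one with two sign changes and one with three, so the product equals
  its own negative.\<close>

lemma mul_four_right: "mul (mul (mul x y) z) w = 0"
proof -
  have "mul (mul (mul x y) z) w = mul x (mul y (mul z w))"
    by (simp only: antiassociative[of "mul x y" z w] antiassociative[of x y "mul z w"] minus_minus)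
  moreover have "mul (mul (mul x y) z) w = - mul (mul x (mul y z)) w"
    by (simp only: antiassociative[of x y z] mul_minus_left)
  moreover have "mul (mul x (mul y z)) w = mul x (mul y (mul z w))"
    by (simp only: antiassociative[of x "mul y z" w] antiassociative[of y z w]
        mul_minus_right minus_minus)
  ultimately have "mul (mul (mul x y) z) w = - mul (mul (mul x y) z) w"
    by simp
  then show ?thesis
    by (rule eq_minus_self)
qed

lemma mul_self: "mul x x = 0"
  using anticommutative by (rule eq_minus_self)

lemma triple_swap: "mul (mul y x) z = - mul (mul x y) z"
  using anticommutative[of y x] by (simp add: bilinear_simps)

lemma triple_rotate: "mul (mul y z) x = mul (mul x y) z"
  using anticommutative[of "mul y z" x] mul_mul_right[of x y z] by simp

lemma triple_repeat:
  "mul (mul x x) y = 0" "mul (mul x y) x = 0" "mul (mul y x) x = 0"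
  using triple_rotate[of x x y] triple_rotate[of x y x] by (simp_all add: mul_self mul_zero_left)

text \<open>Naming the value \<open>t\<close> turns the alternation of triple products into rewrite
  rules that normalise all six orders at once.\<close>

lemma triple_perms:
  assumes "mul (mul x y) z = t"
  shows "mul (mul x y) z = t" "mul (mul y z) x = t" "mul (mul z x) y = t"
    "mul (mul y x) z = - t" "mul (mul z y) x = - t" "mul (mul x z) y = - t"
  using assms triple_rotate[of x y z] triple_rotate[of y z x]
    triple_swap[of x y z] triple_swap[of y z x] triple_swap[of z x y] by (metis minus_minus)+

lemmas triple_simps = mul_mul_right mul_four_right mul_self triple_repeat

lemma triple_nonzero:
  assumes "\<not> lie_algebra scale mul"
  obtains a b c where "mul (mul a b) c \<noteq> 0"
proof (rule ccontr)
  assume "\<not> thesis"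
  then have "mul (mul x y) z = 0" for x y z
    using that by blast
  then have "lie_algebra scale mul"
    by unfold_locales (simp_all add: mul_self)
  then show False
    using assms by blast
qed

lemma triple_annihilates:
  assumes "mul (mul x y) z = t"
  shows "mul t w = 0" "mul w t = 0"
proof -
  show "mul t w = 0"
    using assms mul_four_right by blast
  then show "mul w t = 0"
    using anticommutative[of w t] by simp
qed

section \<open>All triple products lie on one line\<close>

lemma line_independent:
  assumes "s \<notin> span {t}" "t \<noteq> 0" "scale \<alpha> t + scale \<beta> s = 0"
  shows "\<alpha> = 0 \<and> \<beta> = 0"
proof -
  have "\<beta> = 0"
  proof (rule ccontr)
    assume \<beta>: "\<beta> \<noteq> 0"
    have "scale \<beta> s = scale (- \<alpha>) t"
      using assms(3) by (metis add_eq_0_iff scale_minus_left)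
    then have "s = scale (inverse \<beta> * - \<alpha>) t"
      using \<beta> by (metis left_inverse scale_one scale_scale)
    then have "s \<in> span {t}"
      unfolding span_singleton by (rule range_eqI)
    then show False
      using assms(1) by simp
  qed
  then show ?thesis
    using assms by simp
qed

text \<open>Otherwise \<open>a, b, c, d\<close>, the products \<open>a b, a c, b c, a d\<close> and
  the triples \<open>t, s\<close> would be ten independent vectors.\<close>

lemma triple_last_in_span:
  assumes dim: "dim (UNIV :: 'a set) = 9" and t0: "mul (mul a b) c \<noteq> 0"
  shows "mul (mul a b) d \<in> span {mul (mul a b) c}"
proof (rule ccontr)
  define t where "t = mul (mul a b) c"
  define s where "s = mul (mul a b) d"
  assume "mul (mul a b) d \<notin> span {mul (mul a b) c}"
  then have s: "s \<notin> span {t}"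
    by (simp add: t_def s_def)
  have t: "t \<noteq> 0"
    using t0 by (simp add: t_def)
  note perms = triple_perms[OF t_def[symmetric]] triple_annihilates[OF t_def[symmetric]]
    triple_perms[OF s_def[symmetric]] triple_annihilates[OF s_def[symmetric]]
  obtain k :: "nat \<Rightarrow> complex" where
    E: "scale (k 0) a + scale (k 1) b + scale (k 2) c + scale (k 3) d + scale (k 4) (mul a b) +
      scale (k 5) (mul a c) + scale (k 6) (mul b c) + scale (k 7) (mul a d) +
      scale (k 8) t + scale (k 9) s = 0" (is "?v = 0") and
    nz: "\<not> (k 0 = 0 \<and> k 1 = 0 \<and> k 2 = 0 \<and> k 3 = 0 \<and> k 4 = 0 \<and>
        k 5 = 0 \<and> k 6 = 0 \<and> k 7 = 0 \<and> k 8 = 0 \<and> k 9 = 0)"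
    by (rule ten_vectors_dependent[OF dim])
  have L: "mul z ?v = 0" and R: "mul ?v z = 0" for z
    by (simp_all only: E mul_zero_left mul_zero_right)
  note expand = bilinear_simps triple_simps perms
  \<comment> \<open>\<open>a b\<close> sends \<open>c\<close> to \<open>t\<close>, \<open>d\<close>
    to \<open>s\<close> and the other eight vectors to 0. The order of elimination matters: the
    unknown triples \<open>(a c) d\<close> and \<open>(b c) d\<close> arise, up to sign, only with
    coefficients already known to vanish.\<close>
  have "scale (k 2) t + scale (k 3) s = 0"
    using L[of "mul a b"] by (simp add: expand)
  then have z23: "k 2 = 0 \<and> k 3 = 0"
    by (rule line_independent[OF s t])
  have z1: "k 1 = 0"
    using L[of "mul a c"] z23 t by (simp add: expand)
  have z0: "k 0 = 0"
    using L[of "mul b c"] z23 z1 t by (simp add: expand)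
  note z = z23 z1 z0
  have z6: "k 6 = 0"
    using R[of a] z t by (simp add: expand)
  have "scale (k 5) t + scale (k 7) s = 0"
    using L[of b] z z6 by (simp add: expand)
  then have z57: "k 5 = 0 \<and> k 7 = 0"
    by (rule line_independent[OF s t])
  have z4: "k 4 = 0"
    using R[of c] z z6 z57 t by (simp add: expand)
  have "k 8 = 0 \<and> k 9 = 0"
    using E z z6 z57 z4 by (intro line_independent[OF s t]) simp
  then show False
    using nz z z6 z57 z4 by simp
qed

text \<open>Arguments are exchanged one at a time, each time starting from a nonzero triple; if
  \<open>(a b) x\<close> vanishes, \<open>x + c\<close> stands in for \<open>x\<close> and the
  excess is subtracted at the end. With a fixed subspace \<open>S\<close>, a nonzero triple in
  \<open>S\<close> forces the next one into \<open>S\<close>, so no lines have to be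
  compared.\<close>

lemma triple_in_span_aux:
  assumes dim: "dim (UNIV :: 'a set) = 9"
    and S: "subspace S" and abc: "mul (mul a b) c \<noteq> 0" "mul (mul a b) c \<in> S"
  shows "mul (mul a x) y \<in> S"
proof -
  have step: "mul (mul p q) s \<in> S" if "mul (mul p q) r \<noteq> 0" "mul (mul p q) r \<in> S" for p q r s
    using triple_last_in_span[OF dim that(1), of s] span_minimal[of "{mul (mul p q) r}" S] that S
    by auto
  have step': "mul (mul p r) s \<in> S" if "mul (mul p q) r \<noteq> 0" "mul (mul p q) r \<in> S" for p q r s
    using step[of p r q s] that triple_perms(6)[of p q r, OF refl] subspace_neg[OF S] by simp
  show ?thesis
  proof (cases "mul (mul a b) x = 0")
    case True
    then have "mul (mul a b) (x + c) = mul (mul a b) c"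
      by (simp add: bilinear_simps)
    then have "mul (mul a (x + c)) y \<in> S"
      using step'[of a b "x + c" y] abc by simp
    moreover have "mul (mul a c) y \<in> S"
      using step' abc by blast
    ultimately show ?thesis
      using subspace_diff[OF S] by (fastforce simp: bilinear_simps)
  next
    case False
    then show ?thesis
      using step[OF abc] step' by blast
  qed
qed

text \<open>The first argument is exchanged by the same device: when \<open>(a x) c\<close>
  vanishes, \<open>x + b\<close> stands in for \<open>x\<close>.\<close>

lemma triple_in_span:
  assumes dim: "dim (UNIV :: 'a set) = 9" and abc: "mul (mul a b) c \<noteq> 0"
  shows "mul (mul x y) z \<in> span {mul (mul a b) c}"
proof -
  let ?S = "span {mul (mul a b) c}"
  have abcS: "mul (mul a b) c \<in> ?S"
    by (simp add: span_base)
  note aux = triple_in_span_aux[OF dim subspace_span[of "{mul (mul a b) c}"]]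
  have a: "mul (mul a x) y \<in> ?S" for x y
    using aux abc abcS .
  have swap: "mul (mul p y) z \<in> ?S" if "mul (mul a p) q \<noteq> 0" for p q y z
    using aux[of p a q y z] that a[of p q] triple_swap[of p a q] by (simp add: span_neg)
  show ?thesis
  proof (cases "mul (mul a x) c = 0")
    case True
    then have "mul (mul a (x + b)) c = mul (mul a b) c"
      by (simp add: bilinear_simps)
    then have "mul (mul (x + b) y) z \<in> ?S"
      using swap abc by metis
    then have "mul (mul (x + b) y) z - mul (mul b y) z \<in> ?S"
      using swap[OF abc] by (rule span_diff)
    then show ?thesis
      by (simp add: bilinear_simps)
  next
    case False
    then show ?thesis
      by (rule swap)
  qed
qed

section \<open>The radical and its complement spanned by \<open>a, b, c\<close>\<close>

definition radical :: "'a set" where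
  "radical = {x. \<forall>y z. mul (mul x y) z = 0}"

lemma radical_triple:
  assumes "x \<in> radical"
  shows "mul (mul x y) z = 0" "mul (mul y x) z = 0" "mul (mul y z) x = 0"
proof -
  show *: "mul (mul x y) z = 0" for y z
    using assms by (simp add: radical_def)
  show "mul (mul y x) z = 0" "mul (mul y z) x = 0"
    using *[of y z] triple_swap[of y x z] triple_rotate[of y z x] by simp_all
qed

lemma subspace_radical: "subspace radical"
  by (rule subspaceI) (simp_all add: radical_def bilinear_simps)

lemma mul_in_radical: "mul x y \<in> radical"
  by (simp add: radical_def mul_four_right)

text \<open>
  The common kernel of the three functionals dual to \<open>a, b, c\<close> that contraction with
  \<open>(x y) z\<close> provides. It equals the radical, but only one inclusion is needed.
\<close>

definition pair_kernel :: "'a \<Rightarrow> 'a \<Rightarrow> 'a \<Rightarrow> 'a set" where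
  "pair_kernel a b c =
    {x. mul (mul a b) x = 0 \<and> mul (mul b c) x = 0 \<and> mul (mul c a) x = 0}"

text \<open>Otherwise \<open>a, b, c, x, y, a b, a c, b c, a x, t\<close> would be independent: the
  nonzero value \<open>p\<close> detects the coefficients of \<open>x, y, a x\<close>, and
  \<open>t\<close> detects the others.\<close>

lemma pair_kernel_triple:
  assumes dim: "dim (UNIV :: 'a set) = 9" and t0: "mul (mul a b) c \<noteq> 0"
    and x: "x \<in> pair_kernel a b c" and y: "y \<in> pair_kernel a b c"
  shows "mul (mul a x) y = 0"
proof (rule ccontr)
  define t where "t = mul (mul a b) c"
  define p where "p = mul (mul a x) y"
  assume "mul (mul a x) y \<noteq> 0"
  then have p: "p \<noteq> 0"
    by (simp add: p_def)
  have t: "t \<noteq> 0"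
    using t0 by (simp add: t_def)
  have x': "mul (mul a b) x = 0" "mul (mul b c) x = 0" "mul (mul c a) x = 0"
    and y': "mul (mul a b) y = 0" "mul (mul b c) y = 0" "mul (mul c a) y = 0"
    using x y by (simp_all add: pair_kernel_def)
  note perms = triple_perms[OF t_def[symmetric]] triple_annihilates[OF t_def[symmetric]]
    triple_perms[OF p_def[symmetric]] triple_annihilates[OF p_def[symmetric]]
    x'[THEN triple_perms(1)] x'[THEN triple_perms(2)] x'[THEN triple_perms(3)]
    x'[THEN triple_perms(4)] x'[THEN triple_perms(5)] x'[THEN triple_perms(6)]
    y'[THEN triple_perms(1)] y'[THEN triple_perms(2)] y'[THEN triple_perms(3)]
    y'[THEN triple_perms(4)] y'[THEN triple_perms(5)] y'[THEN triple_perms(6)]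
  obtain k :: "nat \<Rightarrow> complex" where
    E: "scale (k 0) a + scale (k 1) b + scale (k 2) c + scale (k 3) x + scale (k 4) y +
      scale (k 5) (mul a b) + scale (k 6) (mul a c) + scale (k 7) (mul b c) +
      scale (k 8) (mul a x) + scale (k 9) t = 0" (is "?v = 0") and
    nz: "\<not> (k 0 = 0 \<and> k 1 = 0 \<and> k 2 = 0 \<and> k 3 = 0 \<and> k 4 = 0 \<and>
        k 5 = 0 \<and> k 6 = 0 \<and> k 7 = 0 \<and> k 8 = 0 \<and> k 9 = 0)"
    by (rule ten_vectors_dependent[OF dim])
  have L: "mul z ?v = 0" and R: "mul ?v z = 0" for z
    by (simp_all only: E mul_zero_left mul_zero_right)
  note expand = bilinear_simps triple_simps perms
  have z0: "k 0 = 0"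
    using L[of "mul b c"] t by (simp add: expand)
  have z1: "k 1 = 0"
    using L[of "mul a c"] t by (simp add: expand)
  have z2: "k 2 = 0"
    using L[of "mul a b"] t by (simp add: expand)
  note z = z0 z1 z2
  have z4: "k 4 = 0"
    using L[of "mul a x"] p z by (simp add: expand)
  have z3: "k 3 = 0"
    using L[of "mul a y"] p z by (simp add: expand)
  have z7: "k 7 = 0"
    using R[of a] t z z3 z4 by (simp add: expand)
  have z6: "k 6 = 0"
    using R[of b] t z z3 z4 z7 by (simp add: expand)
  have z5: "k 5 = 0"
    using R[of c] t z z3 z4 z6 z7 by (simp add: expand)
  have z8: "k 8 = 0"
    using R[of y] p z z3 z4 z5 z6 z7 by (simp add: expand)
  have "k 9 = 0"
    using E z z3 z4 z5 z6 z7 z8 t by simp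
  then show False
    using nz z z3 z4 z5 z6 z7 z8 by simp
qed

lemma pair_kernel_rotate: "pair_kernel b c a = pair_kernel a b c"
  by (auto simp: pair_kernel_def)

text \<open>Triples lie on the line of \<open>t\<close>, so \<open>(b c) x\<close>,
  \<open>(c a) x\<close>, \<open>(a b) x\<close> are numbers in units of \<open>t\<close>; these are
  the coordinates of \<open>x\<close> along \<open>a, b, c\<close>.\<close>

lemma pair_kernel_decomposition:
  assumes dim: "dim (UNIV :: 'a set) = 9" and t0: "mul (mul a b) c \<noteq> 0"
  obtains \<alpha> \<beta> \<gamma> r where "x = scale \<alpha> a + scale \<beta> b + scale \<gamma> c + r" "r \<in> pair_kernel a b c"
proof -
  define t where "t = mul (mul a b) c"
  have "\<exists>\<kappa>. mul (mul y z) x = scale \<kappa> t" for y z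
    using triple_in_span[OF dim t0, of y z x] by (auto simp: t_def span_singleton)
  then obtain \<alpha> \<beta> \<gamma> where *: "mul (mul b c) x = scale \<alpha> t" "mul (mul c a) x = scale \<beta> t"
      "mul (mul a b) x = scale \<gamma> t"
    by metis
  note perms = triple_perms[OF t_def[symmetric]]
  define r where "r = x - (scale \<alpha> a + scale \<beta> b + scale \<gamma> c)"
  have "r \<in> pair_kernel a b c"
    by (simp add: r_def pair_kernel_def bilinear_simps * perms triple_repeat)
  moreover have "x = scale \<alpha> a + scale \<beta> b + scale \<gamma> c + r"
    by (simp add: r_def)
  ultimately show thesis
    using that by blast
qed

text \<open>Splitting the other two arguments along \<open>a, b, c\<close> and the kernel leaves
  triples with one, two or three kernel elements. The first vanish by definition, the second by
  \<open>pair_kernel_triple\<close> and its rotations, the third by a change of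
  \<open>a\<close>.\<close>

lemma pair_kernel_subset_radical:
  assumes dim: "dim (UNIV :: 'a set) = 9" and t0: "mul (mul a b) c \<noteq> 0"
  shows "pair_kernel a b c \<subseteq> radical"
proof
  fix x assume x: "x \<in> pair_kernel a b c"
  have rot: "mul (mul b c) a \<noteq> 0" "mul (mul c a) b \<noteq> 0"
    using t0 triple_rotate[of b c a] triple_rotate[of c a b] by simp_all
  have a: "mul (mul a x) y = 0" and b: "mul (mul b x) y = 0" and c: "mul (mul c x) y = 0"
    if "x \<in> pair_kernel a b c" "y \<in> pair_kernel a b c" for x y
    using pair_kernel_triple[OF dim t0, of x y] pair_kernel_triple[OF dim rot(1), of x y]
      pair_kernel_triple[OF dim rot(2), of x y] that
    by (simp_all add: pair_kernel_rotate)
  have xyz: "mul (mul x y) z = 0"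
    if y: "y \<in> pair_kernel a b c" and z: "z \<in> pair_kernel a b c" for y z
  proof -
    have x': "mul (mul a b) x = 0" "mul (mul b c) x = 0" "mul (mul c a) x = 0"
      and y': "mul (mul a b) y = 0" "mul (mul b c) y = 0" "mul (mul c a) y = 0"
      and z': "mul (mul a b) z = 0" "mul (mul b c) z = 0" "mul (mul c a) z = 0"
      using x y z by (simp_all add: pair_kernel_def)
    note perms = x'[THEN triple_perms(2)] x'[THEN triple_perms(3)]
      b[OF x y, THEN triple_perms(4)] b[OF x z, THEN triple_perms(4)]
      c[OF x y] c[OF x z]
    \<comment> \<open>Replacing \<open>a\<close> by \<open>a + x\<close> reduces this to the triples starting with \<open>a\<close>.\<close>
    have "mul (mul (a + x) b) c \<noteq> 0"
      using t0 by (simp add: bilinear_simps perms)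
    moreover have "y \<in> pair_kernel (a + x) b c" "z \<in> pair_kernel (a + x) b c"
      by (simp_all add: pair_kernel_def bilinear_simps perms y' z')
    ultimately have "mul (mul (a + x) y) z = 0"
      by (rule pair_kernel_triple[OF dim])
    then show ?thesis
      by (simp add: bilinear_simps a[OF y z])
  qed
  have "mul (mul x y) z = 0" for y z
  proof -
    obtain \<alpha> \<beta> \<gamma> y' where y: "y = scale \<alpha> a + scale \<beta> b + scale \<gamma> c + y'"
      and y': "y' \<in> pair_kernel a b c"
      by (rule pair_kernel_decomposition[OF dim t0])
    obtain \<alpha>' \<beta>' \<gamma>' z' where z: "z = scale \<alpha>' a + scale \<beta>' b + scale \<gamma>' c + z'"
      and z': "z' \<in> pair_kernel a b c"
      by (rule pair_kernel_decomposition[OF dim t0])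
    have x': "mul (mul a b) x = 0" "mul (mul b c) x = 0" "mul (mul c a) x = 0"
      using x by (simp_all add: pair_kernel_def)
    note perms = x'[THEN triple_perms(2)] x'[THEN triple_perms(3)] x'[THEN triple_perms(4)]
      x'[THEN triple_perms(5)] x'[THEN triple_perms(6)]
      a[OF x y', THEN triple_perms(2)] b[OF x y', THEN triple_perms(2)]
      c[OF x y', THEN triple_perms(2)]
      a[OF x z', THEN triple_perms(4)] b[OF x z', THEN triple_perms(4)]
      c[OF x z', THEN triple_perms(4)]
    show ?thesis
      by (simp add: y z bilinear_simps triple_repeat perms xyz[OF y' z'])
  qed
  then show "x \<in> radical"
    by (simp add: radical_def)
qed

lemma radical_decomposition:
  assumes "dim (UNIV :: 'a set) = 9" and "mul (mul a b) c \<noteq> 0"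
  obtains \<alpha> \<beta> \<gamma> r where "x = scale \<alpha> a + scale \<beta> b + scale \<gamma> c + r" "r \<in> radical"
  using pair_kernel_decomposition[OF assms, of x] pair_kernel_subset_radical[OF assms] that
  by (metis subsetD)

text \<open>Otherwise \<open>a, b, c, x, y, a b, a c, b c, t, x y\<close> would be independent. As
  \<open>x\<close> and \<open>y\<close> annihilate all products, each of them detects the
  coefficient of the other once those of \<open>a, b, c\<close> are gone.\<close>

lemma radical_mul_radical:
  assumes dim: "dim (UNIV :: 'a set) = 9" and t0: "mul (mul a b) c \<noteq> 0"
    and x: "x \<in> radical" and y: "y \<in> radical"
  shows "mul x y \<in> span {mul (mul a b) c}"
proof (rule ccontr)
  define t where "t = mul (mul a b) c"
  assume "mul x y \<notin> span {mul (mul a b) c}"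
  then have s: "mul x y \<notin> span {t}"
    by (simp add: t_def)
  then have s0: "mul x y \<noteq> 0"
    using span_zero by metis
  have t: "t \<noteq> 0"
    using t0 by (simp add: t_def)
  note perms = triple_perms[OF t_def[symmetric]] triple_annihilates[OF t_def[symmetric]]
    radical_triple[OF x] radical_triple[OF y]
  obtain k :: "nat \<Rightarrow> complex" where
    E: "scale (k 0) a + scale (k 1) b + scale (k 2) c + scale (k 3) x + scale (k 4) y +
      scale (k 5) (mul a b) + scale (k 6) (mul a c) + scale (k 7) (mul b c) +
      scale (k 8) t + scale (k 9) (mul x y) = 0" (is "?v = 0") and
    nz: "\<not> (k 0 = 0 \<and> k 1 = 0 \<and> k 2 = 0 \<and> k 3 = 0 \<and> k 4 = 0 \<and>
        k 5 = 0 \<and> k 6 = 0 \<and> k 7 = 0 \<and> k 8 = 0 \<and> k 9 = 0)"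
    by (rule ten_vectors_dependent[OF dim])
  have L: "mul z ?v = 0" and R: "mul ?v z = 0" for z
    by (simp_all only: E mul_zero_left mul_zero_right)
  note expand = bilinear_simps triple_simps perms
  have z0: "k 0 = 0"
    using L[of "mul b c"] t by (simp add: expand)
  have z1: "k 1 = 0"
    using L[of "mul a c"] t by (simp add: expand)
  have z2: "k 2 = 0"
    using L[of "mul a b"] t by (simp add: expand)
  note z = z0 z1 z2
  have z4: "k 4 = 0"
    using L[of x] s0 z by (simp add: expand)
  have z3: "k 3 = 0"
    using R[of y] s0 z z4 by (simp add: expand)
  have z7: "k 7 = 0"
    using R[of a] t z z3 z4 by (simp add: expand)
  have z6: "k 6 = 0"
    using R[of b] t z z3 z4 z7 by (simp add: expand)
  have z5: "k 5 = 0"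
    using R[of c] t z z3 z4 z6 z7 by (simp add: expand)
  have "k 8 = 0 \<and> k 9 = 0"
    using E z z3 z4 z5 z6 z7 by (intro line_independent[OF s t]) simp
  then show False
    using nz z z3 z4 z5 z6 z7 by simp
qed

section \<open>Bases adapted to the two tables\<close>

lemma isomorphic_D9_37:
  assumes dim: "dim (UNIV :: 'a set) = 9" and t0: "mul (mul a b) c \<noteq> 0"
    and x: "x \<in> radical" and xa: "mul x a = 0" and xb: "mul x b = 0"
    and xc: "mul x c \<notin> span {mul (mul a b) c}"
  shows "algebra_isomorphic scale mul (*s) D9_37"
proof -
  define t where "t = mul (mul a b) c"
  define w where "w = mul x c"
  have t: "t \<noteq> 0" and w: "w \<notin> span {t}"
    using t0 xc by (simp_all add: t_def w_def)
  have w_zero: "mul w z = 0" "mul z w = 0" for z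
    using radical_triple[OF x] by (simp_all add: w_def mul_mul_right)
  have x_products: "mul x a = 0" "mul a x = 0" "mul x b = 0" "mul b x = 0"
      "mul x c = w" "mul c x = - w"
    using xa xb anticommutative[of a x] anticommutative[of b x] anticommutative[of c x]
    by (simp_all add: w_def)
  have neg: "mul b a = - mul a b" "mul c a = - mul a c" "mul c b = - mul b c"
    by (rule anticommutative)+
  note expand = bilinear_simps triple_simps triple_perms[OF t_def[symmetric]]
    triple_annihilates[OF t_def[symmetric]] radical_triple[OF x] w_zero x_products
  \<comment> \<open>Antiassociativity gives \<open>a (b c) = - t\<close>, hence the sign of the
    eighth vector. The nine updates exhaust the index type, so the default 0 is never taken.\<close>
  define e :: "9 \<Rightarrow> 'a" where "e = (\<lambda>_. 0)(1 := a, 2 := b, 3 := c, 4 := mul a b, 5 := mul a c,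
    6 := mul b c, 7 := x, 8 := - t, 9 := w)"
  have e: "e 1 = a" "e 2 = b" "e 3 = c" "e 4 = mul a b" "e 5 = mul a c" "e 6 = mul b c"
      "e 7 = x" "e 8 = - t" "e 9 = w"
    by (simp_all add: e_def)
  show ?thesis
    unfolding D9_37_def
  proof (rule isomorphic_table_mult[where e = e])
    show "dim (UNIV :: 'a set) = CARD(9)"
      using dim by simp
  next
    fix k :: "9 \<Rightarrow> complex"
    assume "(\<Sum>i\<in>UNIV. scale (k i) (e i)) = 0"
    then have E: "scale (k 1) a + scale (k 2) b + scale (k 3) c + scale (k 4) (mul a b) +
        scale (k 5) (mul a c) + scale (k 6) (mul b c) + scale (k 7) x + scale (k 8) (- t) +
        scale (k 9) w = 0" (is "?v = 0")
      by (simp only: sum_UNIV_9 e)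
    have L: "mul z ?v = 0" and R: "mul ?v z = 0" for z
      by (simp_all only: E mul_zero_left mul_zero_right)
    have z1: "k 1 = 0"
      using L[of "mul b c"] t by (simp add: expand)
    have z2: "k 2 = 0"
      using L[of "mul a c"] t by (simp add: expand)
    have z3: "k 3 = 0"
      using L[of "mul a b"] t by (simp add: expand)
    \<comment> \<open>Multiplication by \<open>c\<close> leaves both \<open>a b\<close> and
      \<open>x\<close> visible; the independence of \<open>t\<close> and \<open>w\<close> separates
      them.\<close>
    have "scale (k 4) t + scale (k 7) w = 0"
      using R[of c] z1 z2 z3 by (simp add: expand)
    then have z47: "k 4 = 0 \<and> k 7 = 0"
      by (rule line_independent[OF w t])
    have z5: "k 5 = 0"
      using R[of b] t z1 z2 z3 z47 by (simp add: expand)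
    have z6: "k 6 = 0"
      using R[of a] t z1 z2 z3 z47 by (simp add: expand)
    have "scale (- k 8) t + scale (k 9) w = 0"
      using E z1 z2 z3 z47 z5 z6 by simp
    then have "- k 8 = 0 \<and> k 9 = 0"
      by (rule line_independent[OF w t])
    then show "\<forall>i. k i = 0"
      using z1 z2 z3 z47 z5 z6 by (simp add: all_9)
  next
    have "\<forall>i j. mul (e i) (e j) = (\<Sum>(p, q, k, c)\<leftarrow>[(1, 2, 4, 1), (1, 3, 5, 1), (2, 3, 6, 1),
        (1, 6, 8, 1), (2, 5, 8, -1), (3, 4, 8, 1), (3, 7, 9, -1)].
        scale (c * (of_bool (p = i \<and> q = j) - of_bool (p = j \<and> q = i))) (e k))"
      unfolding all_9 by (intro conjI; simp add: e expand neg)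
    then show "mul (e i) (e j) = (\<Sum>(p, q, k, c)\<leftarrow>[(1, 2, 4, 1), (1, 3, 5, 1), (2, 3, 6, 1),
        (1, 6, 8, 1), (2, 5, 8, -1), (3, 4, 8, 1), (3, 7, 9, -1)].
        scale (c * (of_bool (p = i \<and> q = j) - of_bool (p = j \<and> q = i))) (e k))" for i j
      by blast
  qed
qed

lemma isomorphic_D9_38:
  assumes dim: "dim (UNIV :: 'a set) = 9" and t0: "mul (mul a b) c \<noteq> 0"
    and x: "x \<in> radical" "mul x a = 0" "mul x b = 0" "mul x c = 0"
    and y: "y \<in> radical" "mul y a = 0" "mul y b = 0" "mul y c = 0"
    and xy: "mul x y = - mul (mul a b) c"
  shows "algebra_isomorphic scale mul (*s) D9_38"
proof -
  define t where "t = mul (mul a b) c"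
  have t: "t \<noteq> 0"
    using t0 by (simp add: t_def)
  have products: "mul x a = 0" "mul a x = 0" "mul x b = 0" "mul b x = 0" "mul x c = 0"
      "mul c x = 0" "mul y a = 0" "mul a y = 0" "mul y b = 0" "mul b y = 0" "mul y c = 0"
      "mul c y = 0" "mul x y = - t" "mul y x = t"
    using x y xy anticommutative[of a x] anticommutative[of b x] anticommutative[of c x]
      anticommutative[of a y] anticommutative[of b y] anticommutative[of c y]
      anticommutative[of y x]
    by (simp_all add: t_def)
  have neg: "mul b a = - mul a b" "mul c a = - mul a c" "mul c b = - mul b c"
    by (rule anticommutative)+
  note expand = bilinear_simps triple_simps triple_perms[OF t_def[symmetric]]
    triple_annihilates[OF t_def[symmetric]] radical_triple[OF x(1)] radical_triple[OF y(1)]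
    products
  \<comment> \<open>The ninth vector is \<open>- t\<close> because both \<open>a (b c)\<close> and
    \<open>x y\<close> equal \<open>- t\<close>.\<close>
  define e :: "9 \<Rightarrow> 'a" where "e = (\<lambda>_. 0)(1 := a, 2 := b, 3 := c, 4 := mul a b, 5 := mul a c,
    6 := mul b c, 7 := x, 8 := y, 9 := - t)"
  have e: "e 1 = a" "e 2 = b" "e 3 = c" "e 4 = mul a b" "e 5 = mul a c" "e 6 = mul b c"
      "e 7 = x" "e 8 = y" "e 9 = - t"
    by (simp_all add: e_def)
  show ?thesis
    unfolding D9_38_def
  proof (rule isomorphic_table_mult[where e = e])
    show "dim (UNIV :: 'a set) = CARD(9)"
      using dim by simp
  next
    fix k :: "9 \<Rightarrow> complex"
    assume "(\<Sum>i\<in>UNIV. scale (k i) (e i)) = 0"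
    then have E: "scale (k 1) a + scale (k 2) b + scale (k 3) c + scale (k 4) (mul a b) +
        scale (k 5) (mul a c) + scale (k 6) (mul b c) + scale (k 7) x + scale (k 8) y +
        scale (k 9) (- t) = 0" (is "?v = 0")
      by (simp only: sum_UNIV_9 e)
    have L: "mul z ?v = 0" and R: "mul ?v z = 0" for z
      by (simp_all only: E mul_zero_left mul_zero_right)
    have z1: "k 1 = 0"
      using L[of "mul b c"] t by (simp add: expand)
    have z2: "k 2 = 0"
      using L[of "mul a c"] t by (simp add: expand)
    have z3: "k 3 = 0"
      using L[of "mul a b"] t by (simp add: expand)
    have z7: "k 7 = 0"
      using R[of y] t z1 z2 z3 by (simp add: expand)
    have z8: "k 8 = 0"
      using R[of x] t z1 z2 z3 by (simp add: expand)
    have z4: "k 4 = 0"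
      using R[of c] t z1 z2 z3 z7 z8 by (simp add: expand)
    have z5: "k 5 = 0"
      using R[of b] t z1 z2 z3 z7 z8 by (simp add: expand)
    have z6: "k 6 = 0"
      using R[of a] t z1 z2 z3 z7 z8 by (simp add: expand)
    have "k 9 = 0"
      using E t z1 z2 z3 z4 z5 z6 z7 z8 by simp
    then show "\<forall>i. k i = 0"
      using z1 z2 z3 z4 z5 z6 z7 z8 by (simp add: all_9)
  next
    have "\<forall>i j. mul (e i) (e j) = (\<Sum>(p, q, k, c)\<leftarrow>[(1, 2, 4, 1), (1, 3, 5, 1), (2, 3, 6, 1),
        (1, 6, 9, 1), (2, 5, 9, -1), (3, 4, 9, 1), (7, 8, 9, 1)].
        scale (c * (of_bool (p = i \<and> q = j) - of_bool (p = j \<and> q = i))) (e k))"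
      unfolding all_9 by (intro conjI; simp add: e expand neg)
    then show "mul (e i) (e j) = (\<Sum>(p, q, k, c)\<leftarrow>[(1, 2, 4, 1), (1, 3, 5, 1), (2, 3, 6, 1),
        (1, 6, 9, 1), (2, 5, 9, -1), (3, 4, 9, 1), (7, 8, 9, 1)].
        scale (c * (of_bool (p = i \<and> q = j) - of_bool (p = j \<and> q = i))) (e k))" for i j
      by blast
  qed
qed

section \<open>Radical products off the line of \<open>t\<close>: the first table\<close>

text \<open>Intended for \<open>z = x a\<close> and \<open>z = x b\<close>. Multiplications do not
  see \<open>z\<close>, so in a relation between \<open>z\<close> and
  \<open>a, b, c, x, a b, a c, b c, t, x c\<close> the coefficients of
  \<open>a, b, c, x, a b, a c, b c\<close> vanish.\<close>

lemma annihilator_in_span: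
  assumes dim: "dim (UNIV :: 'a set) = 9" and t0: "mul (mul a b) c \<noteq> 0"
    and x: "x \<in> radical" and xc: "mul x c \<notin> span {mul (mul a b) c}"
    and z0: "\<And>y. mul z y = 0"
  obtains \<alpha> \<beta> where "z = scale \<alpha> (mul (mul a b) c) + scale \<beta> (mul x c)"
proof -
  define t where "t = mul (mul a b) c"
  define w where "w = mul x c"
  have t: "t \<noteq> 0" and w: "w \<notin> span {t}"
    using t0 xc by (simp_all add: t_def w_def)
  have w_zero: "mul w z = 0" "mul z w = 0" for z
    using radical_triple[OF x] by (simp_all add: w_def mul_mul_right)
  have z0': "mul y z = 0" for y
    using z0[of y] anticommutative[of y z] by simp
  obtain k :: "nat \<Rightarrow> complex" where
    E: "scale (k 0) a + scale (k 1) b + scale (k 2) c + scale (k 3) x + scale (k 4) (mul a b) +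
      scale (k 5) (mul a c) + scale (k 6) (mul b c) + scale (k 7) t + scale (k 8) w +
      scale (k 9) z = 0" (is "?v = 0") and
    nz: "\<not> (k 0 = 0 \<and> k 1 = 0 \<and> k 2 = 0 \<and> k 3 = 0 \<and> k 4 = 0 \<and>
        k 5 = 0 \<and> k 6 = 0 \<and> k 7 = 0 \<and> k 8 = 0 \<and> k 9 = 0)"
    by (rule ten_vectors_dependent[OF dim])
  have L: "mul u ?v = 0" and R: "mul ?v u = 0" for u
    by (simp_all only: E mul_zero_left mul_zero_right)
  note expand = bilinear_simps triple_simps triple_perms[OF t_def[symmetric]]
    triple_annihilates[OF t_def[symmetric]] radical_triple[OF x] w_zero z0 z0'
  have k0: "k 0 = 0"
    using L[of "mul b c"] t by (simp add: expand)
  have k1: "k 1 = 0"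
    using L[of "mul a c"] t by (simp add: expand)
  have k2: "k 2 = 0"
    using L[of "mul a b"] t by (simp add: expand)
  have "scale (k 4) t + scale (k 3) w = 0"
    using R[of c] k0 k1 k2 by (simp add: expand w_def[symmetric] add.commute)
  then have k34: "k 4 = 0 \<and> k 3 = 0"
    by (rule line_independent[OF w t])
  have k5: "k 5 = 0"
    using R[of b] t k0 k1 k2 k34 by (simp add: expand)
  have k6: "k 6 = 0"
    using R[of a] t k0 k1 k2 k34 by (simp add: expand)
  note k = k0 k1 k2 k34 k5 k6
  have E': "scale (k 7) t + scale (k 8) w + scale (k 9) z = 0"
    using E k by simp
  \<comment> \<open>\<open>t\<close> and \<open>w\<close> are independent, so a nontrivial relation
    must involve \<open>z\<close>.\<close>
  have "k 9 \<noteq> 0"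
  proof
    assume "k 9 = 0"
    then have "k 7 = 0 \<and> k 8 = 0"
      using E' by (intro line_independent[OF w t]) simp
    then show False
      using nz k \<open>k 9 = 0\<close> by simp
  qed
  have "scale (k 9) z = scale (- k 7) t + scale (- k 8) w"
    using E' by (simp add: add_eq_0_iff)
  then have "scale (inverse (k 9)) (scale (k 9) z) =
      scale (inverse (k 9) * - k 7) t + scale (inverse (k 9) * - k 8) w"
    by (simp add: scale_right_distrib scale_right_diff_distrib)
  then have "z = scale (inverse (k 9) * - k 7) t + scale (inverse (k 9) * - k 8) w"
    using \<open>k 9 \<noteq> 0\<close> by simp
  then show thesis
    unfolding t_def w_def by (rule that)
qed

lemma isomorphic_D9_37_of_large_radical_product:
  assumes dim: "dim (UNIV :: 'a set) = 9" and t0: "mul (mul a b) c \<noteq> 0"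
    and x: "x \<in> radical" and xc: "mul x c \<notin> span {mul (mul a b) c}"
  shows "algebra_isomorphic scale mul (*s) D9_37"
proof -
  define t where "t = mul (mul a b) c"
  have zero: "mul (mul x y) z = 0" for y z
    using radical_triple[OF x] by simp
  obtain \<alpha> \<alpha>' where xa: "mul x a = scale \<alpha>' t + scale \<alpha> (mul x c)"
    unfolding t_def by (rule annihilator_in_span[OF dim t0 x xc zero])
  obtain \<beta> \<beta>' where xb: "mul x b = scale \<beta>' t + scale \<beta> (mul x c)"
    unfolding t_def by (rule annihilator_in_span[OF dim t0 x xc zero])
  \<comment> \<open>Shifts by \<open>c\<close> cancel the \<open>x c\<close> components of
    \<open>x a\<close> and \<open>x b\<close>. Products then cancel the \<open>t\<close> components,
    with signs given by \<open>(b' c) a' = t\<close> and \<open>(a' c) b' = - t\<close>.\<close>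
  define a' where "a' = a - scale \<alpha> c"
  define b' where "b' = b - scale \<beta> c"
  define x' where "x' = x - scale \<alpha>' (mul b' c) + scale \<beta>' (mul a' c)"
  have t': "mul (mul a' b') c = t"
    by (simp add: a'_def b'_def bilinear_simps triple_repeat t_def)
  have x'c: "mul x' c = mul x c"
    by (simp add: x'_def bilinear_simps triple_repeat)
  have xa': "mul x a' = scale \<alpha>' t" and xb': "mul x b' = scale \<beta>' t"
    by (simp_all add: a'_def b'_def bilinear_simps xa xb)
  show ?thesis
  proof (rule isomorphic_D9_37[OF dim])
    show "mul (mul a' b') c \<noteq> 0"
      using t0 by (simp add: t' t_def)
    show "x' \<in> radical"
      unfolding x'_def
      by (intro subspace_add[OF subspace_radical] subspace_diff[OF subspace_radical]
          subspace_scale[OF subspace_radical] x mul_in_radical)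
    show "mul x' a' = 0" "mul x' b' = 0"
      by (simp_all add: x'_def bilinear_simps triple_repeat xa' xb' triple_perms[OF t'])
    show "mul x' c \<notin> span {mul (mul a' b') c}"
      using xc by (simp add: x'c t' t_def)
  qed
qed

section \<open>Radical products on the line of \<open>t\<close>: the second table\<close>

definition complement_annihilator :: "'a \<Rightarrow> 'a \<Rightarrow> 'a \<Rightarrow> 'a set" where
  "complement_annihilator a b c = {x \<in> radical. mul x a = 0 \<and> mul x b = 0 \<and> mul x c = 0}"

text \<open>A radical element sends each of \<open>a, b, c\<close> to a multiple of
  \<open>t\<close>, and some combination of \<open>b c, a c, a b\<close> does exactly the same; the
  difference of the two is \<open>n\<close>.\<close>

lemma complement_annihilator_decomposition:
  assumes dim: "dim (UNIV :: 'a set) = 9" and t0: "mul (mul a b) c \<noteq> 0"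
    and small: "\<And>x y. x \<in> radical \<Longrightarrow> mul x y \<in> span {mul (mul a b) c}"
  obtains \<alpha> \<beta> \<gamma> \<alpha>' \<beta>' \<gamma>' n where "n \<in> complement_annihilator a b c"
    "x = scale \<alpha> a + scale \<beta> b + scale \<gamma> c +
      (scale \<alpha>' (mul b c) + scale \<beta>' (mul a c) + scale \<gamma>' (mul a b)) + n"
proof -
  define t where "t = mul (mul a b) c"
  obtain \<alpha> \<beta> \<gamma> r where xr: "x = scale \<alpha> a + scale \<beta> b + scale \<gamma> c + r" and r: "r \<in> radical"
    by (rule radical_decomposition[OF dim t0])
  have "\<exists>\<kappa>. mul r y = scale \<kappa> t" for y
    using small[OF r, of y] by (auto simp: t_def span_singleton)
  then obtain \<alpha>' \<beta>' \<gamma>' where p: "mul r a = scale \<alpha>' t" "mul r b = scale \<beta>' t" "mul r c = scale \<gamma>' t"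
    by metis
  \<comment> \<open>The minus sign comes from \<open>(a c) b = - t\<close>.\<close>
  define m where "m = scale \<alpha>' (mul b c) + scale (- \<beta>') (mul a c) + scale \<gamma>' (mul a b)"
  have "r - m \<in> radical"
    unfolding m_def by (intro subspace_add[OF subspace_radical] subspace_diff[OF subspace_radical]
          subspace_scale[OF subspace_radical] r mul_in_radical)
  then have "r - m \<in> complement_annihilator a b c"
    by (simp add: complement_annihilator_def m_def bilinear_simps p triple_repeat
        triple_perms[OF t_def[symmetric]])
  then show thesis
    by (rule that[of _ \<alpha> \<beta> \<gamma> \<alpha>' "- \<beta>'" \<gamma>']) (simp add: xr m_def)
qed

text \<open>Indecomposability serves to force a nonzero product inside
  \<open>complement_annihilator a b c\<close>; rescaling one factor then yields the second
  table.\<close>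

lemma isomorphic_D9_38_of_small_radical_products:
  assumes dim: "dim (UNIV :: 'a set) = 9" and t0: "mul (mul a b) c \<noteq> 0"
    and small: "\<And>x y. x \<in> radical \<Longrightarrow> mul x y \<in> span {mul (mul a b) c}"
    and indecomposable: indecomposable
  shows "algebra_isomorphic scale mul (*s) D9_38"
proof -
  define t where "t = mul (mul a b) c"
  let ?N = "complement_annihilator a b c"
  have "\<exists>u\<in>?N. \<exists>v\<in>?N. mul u v \<noteq> 0"
  proof (rule ccontr)
    assume "\<not> (\<exists>u\<in>?N. \<exists>v\<in>?N. mul u v \<noteq> 0)"
    then have NN: "mul u v = 0" if "u \<in> ?N" "v \<in> ?N" for u v
      using that by blast
    \<comment> \<open>Elements of \<open>?N\<close> annihilate \<open>a, b, c\<close> by definition,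
      products of these by radicality and \<open>?N\<close> by assumption, hence everything.\<close>
    have N_left: "mul n y = 0" if n: "n \<in> ?N" for n y
    proof -
      obtain \<alpha> \<beta> \<gamma> \<alpha>' \<beta>' \<gamma>' m where m: "m \<in> ?N"
        and y: "y = scale \<alpha> a + scale \<beta> b + scale \<gamma> c +
          (scale \<alpha>' (mul b c) + scale \<beta>' (mul a c) + scale \<gamma>' (mul a b)) + m"
        by (rule complement_annihilator_decomposition[OF dim t0 small])
      have r: "n \<in> radical" and z: "mul n a = 0" "mul n b = 0" "mul n c = 0"
        using n by (simp_all add: complement_annihilator_def)
      show ?thesis
        by (simp add: y bilinear_simps mul_mul_right radical_triple[OF r] z NN[OF n m])
    qed
    have N_right: "mul y n = 0" if n: "n \<in> ?N" for n y
      using N_left[OF n, of y] anticommutative[of y n] by simp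
    define S where "S = {a, b, c, mul a b, mul a c, mul b c, t}"
    \<comment> \<open>\<open>S\<close> and \<open>?N\<close> together span the algebra, and seven
      vectors alone cannot span nine dimensions.\<close>
    have "\<exists>u\<in>?N. u \<notin> span S"
    proof (rule ccontr)
      assume "\<not> (\<exists>u\<in>?N. u \<notin> span S)"
      then have NS: "n \<in> span S" if "n \<in> ?N" for n
        using that by blast
      have "x \<in> span S" for x
      proof -
        obtain \<alpha> \<beta> \<gamma> \<alpha>' \<beta>' \<gamma>' m where m: "m \<in> ?N"
          and x: "x = scale \<alpha> a + scale \<beta> b + scale \<gamma> c +
            (scale \<alpha>' (mul b c) + scale \<beta>' (mul a c) + scale \<gamma>' (mul a b)) + m"
          by (rule complement_annihilator_decomposition[OF dim t0 small])
        show ?thesis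
          unfolding x by (intro span_add span_scale NS m span_base) (simp_all add: S_def)
      qed
      then have "dim (UNIV :: 'a set) \<le> card S"
        by (intro dim_le_card) (auto simp: S_def)
      moreover have "card S \<le> 7"
        unfolding S_def
        by (rule order_trans[OF card_length[of "[a, b, c, mul a b, mul a c, mul b c, t]",
          simplified]]) simp
      ultimately show False
        using dim by simp
    qed
    then obtain u where u: "u \<in> ?N" "u \<notin> span S"
      by blast
    obtain J where J: "subspace J" "S \<subseteq> J" "u \<notin> J" and J_sum: "\<forall>x. \<exists>k. x - scale k u \<in> J"
      by (rule separating_subspace[OF u(2)])
    have mem: "mul a b \<in> J" "mul a c \<in> J" "mul b c \<in> J" "t \<in> J"
      using J(2) by (simp_all add: S_def)
    have neg: "mul b a = - mul a b" "mul c a = - mul a c" "mul c b = - mul b c"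
      by (rule anticommutative)+
    \<comment> \<open>Since \<open>?N\<close> annihilates everything, all products are combinations
      of \<open>a b, a c, b c, t\<close>. A subspace containing all products is an ideal.\<close>
    have products: "mul x y \<in> J" for x y
    proof -
      obtain \<alpha> \<beta> \<gamma> \<alpha>' \<beta>' \<gamma>' m where m: "m \<in> ?N"
        and x: "x = scale \<alpha> a + scale \<beta> b + scale \<gamma> c +
          (scale \<alpha>' (mul b c) + scale \<beta>' (mul a c) + scale \<gamma>' (mul a b)) + m"
        by (rule complement_annihilator_decomposition[OF dim t0 small])
      obtain \<alpha>1 \<beta>1 \<gamma>1 \<alpha>1' \<beta>1' \<gamma>1' m1 where m1: "m1 \<in> ?N"
        and y: "y = scale \<alpha>1 a + scale \<beta>1 b + scale \<gamma>1 c +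
          (scale \<alpha>1' (mul b c) + scale \<beta>1' (mul a c) + scale \<gamma>1' (mul a b)) + m1"
        by (rule complement_annihilator_decomposition[OF dim t0 small])
      show ?thesis
        unfolding x y
        by (simp only: bilinear_simps triple_simps triple_perms[OF t_def[symmetric]]
            triple_annihilates[OF t_def[symmetric]] neg N_left[OF m] N_right[OF m1])
          (intro mem subspace_add[OF J(1)] subspace_scale[OF J(1)] subspace_neg[OF J(1)]
            subspace_0[OF J(1)])
    qed
    have "ideal J"
      using J(1) products by (simp add: ideal_def)
    moreover have "ideal (span {u})"
    proof -
      have "mul x v = 0 \<and> mul v x = 0" if "v \<in> span {u}" for v x
        using that N_left[OF u(1)] N_right[OF u(1)] by (auto simp: span_singleton bilinear_simps)
      then show ?thesis
        by (simp add: ideal_def span_zero)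
    qed
    moreover have "span {u} \<noteq> {0}"
    proof -
      have "u \<noteq> 0"
        using subspace_0[OF J(1)] J(3) by metis
      moreover have "u \<in> span {u}"
        by (rule span_base) simp
      ultimately show ?thesis
        by (metis singletonD)
    qed
    moreover have "J \<noteq> {0}"
      using mem(4) t0 by (auto simp: t_def)
    moreover have "span {u} \<inter> J = {0}"
    proof -
      have "v = 0" if v: "v \<in> span {u}" "v \<in> J" for v
      proof (rule ccontr)
        assume "v \<noteq> 0"
        moreover obtain k where k: "v = scale k u"
          using v(1) unfolding span_singleton by (rule rangeE)
        ultimately have "u = scale (inverse k) v"
          by simp
        then show False
          using subspace_scale[OF J(1) v(2)] J(3) by simp
      qed
      then show ?thesis
        using subspace_0[OF J(1)] span_zero[of "{u}"] by (intro equalityI subsetI) auto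
    qed
    moreover have "{p + q | p q. p \<in> span {u} \<and> q \<in> J} = UNIV"
    proof -
      have "\<exists>p q. x = p + q \<and> p \<in> span {u} \<and> q \<in> J" for x
      proof -
        obtain k where "x - scale k u \<in> J"
          using J_sum by blast
        moreover have "scale k u \<in> span {u}"
          by (intro span_scale span_base) simp
        ultimately show ?thesis
          by (intro exI[of _ "scale k u"] exI[of _ "x - scale k u"]) simp
      qed
      then show ?thesis
        by blast
    qed
    ultimately show False
      using indecomposable unfolding indecomposable_def by blast
  qed
  then obtain u v where u: "u \<in> ?N" and v: "v \<in> ?N" and uv: "mul u v \<noteq> 0"
    by blast
  have ur: "u \<in> radical" "mul u a = 0" "mul u b = 0" "mul u c = 0"
    and vr: "v \<in> radical" "mul v a = 0" "mul v b = 0" "mul v c = 0"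
    using u v by (simp_all add: complement_annihilator_def)
  obtain \<kappa> where \<kappa>: "mul u v = scale \<kappa> t"
    using small[OF ur(1), of v] by (auto simp: t_def span_singleton)
  then have "\<kappa> \<noteq> 0"
    using uv by auto
  \<comment> \<open>The factor makes \<open>u v' = - t\<close>, the ninth vector of the basis for
    the second table.\<close>
  define v' where "v' = scale (- inverse \<kappa>) v"
  show ?thesis
  proof (rule isomorphic_D9_38[OF dim t0 ur])
    show "v' \<in> radical"
      unfolding v'_def by (rule subspace_scale[OF subspace_radical vr(1)])
    show "mul v' a = 0" "mul v' b = 0" "mul v' c = 0"
      by (simp_all add: v'_def bilinear_simps vr)
    show "mul u v' = - mul (mul a b) c"
      using \<open>\<kappa> \<noteq> 0\<close> by (simp add: v'_def bilinear_simps \<kappa> t_def)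
  qed
qed

lemma isomorphic_D9_37_or_D9_38:
  assumes dim: "dim (UNIV :: 'a set) = 9" and indecomposable and "\<not> lie_algebra scale mul"
  shows "algebra_isomorphic scale mul (*s) D9_37 \<or> algebra_isomorphic scale mul (*s) D9_38"
proof -
  obtain a b c where t0: "mul (mul a b) c \<noteq> 0"
    using triple_nonzero[OF assms(3)] .
  let ?T = "span {mul (mul a b) c}"
  show ?thesis
  proof (cases "\<forall>x\<in>radical. mul x a \<in> ?T \<and> mul x b \<in> ?T \<and> mul x c \<in> ?T")
    case True
    \<comment> \<open>Products of two radical elements lie in \<open>?T\<close> in any case, so the
      condition on \<open>a, b, c\<close> extends to all \<open>y\<close>.\<close>
    have "mul x y \<in> ?T" if x: "x \<in> radical" for x y
    proof -
      obtain \<alpha> \<beta> \<gamma> r where y: "y = scale \<alpha> a + scale \<beta> b + scale \<gamma> c + r" and r: "r \<in> radical"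
        by (rule radical_decomposition[OF dim t0])
      have "mul x a \<in> ?T" "mul x b \<in> ?T" "mul x c \<in> ?T"
        using True x by simp_all
      then show ?thesis
        unfolding y mul_add_right mul_scale_right
        by (intro span_add span_scale radical_mul_radical[OF dim t0 x r])
    qed
    then show ?thesis
      using isomorphic_D9_38_of_small_radical_products[OF dim t0] assms(2) by simp
  next
    case False
    then obtain x where x: "x \<in> radical" and
      "mul x a \<notin> ?T \<or> mul x b \<notin> ?T \<or> mul x c \<notin> ?T"
      by blast
    \<comment> \<open>Rotating \<open>a, b, c\<close> keeps \<open>t\<close> and moves the factor
      whose product with \<open>x\<close> leaves \<open>?T\<close> to the last place.\<close>
    moreover have "mul (mul b c) a = mul (mul a b) c" "mul (mul c a) b = mul (mul a b) c"
      using triple_rotate[of b c a] triple_rotate[of c a b] by simp_all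
    ultimately have "algebra_isomorphic scale mul (*s) D9_37"
      using isomorphic_D9_37_of_large_radical_product[OF dim _ x, of a b c]
        isomorphic_D9_37_of_large_radical_product[OF dim _ x, of b c a]
        isomorphic_D9_37_of_large_radical_product[OF dim _ x, of c a b] t0 by auto
    then show ?thesis ..
  qed
qed

end

theorem theorem3:
  fixes scale :: "complex \<Rightarrow> 'a::ab_group_add \<Rightarrow> 'a"
    and mul :: "'a \<Rightarrow> 'a \<Rightarrow> 'a"
  assumes "dual_mock_lie_algebra scale mul"
    and "vector_space.dim scale (UNIV :: 'a set) = 9"
    and "nonassoc_algebra.indecomposable scale mul"
    and "\<not> lie_algebra scale mul"
  shows "algebra_isomorphic scale mul (*s) D9_37 \<or>
    algebra_isomorphic scale mul (*s) D9_38"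
  using assms by (rule dual_mock_lie_algebra.isomorphic_D9_37_or_D9_38)

end
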